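(* Let $X$ be a Banach space and let $A:X\times\mathbb{R}\to\mathrm{SL}(2,\mathbb{R})$ be analytic. If $A$ is non-ahyperbolic, then $A$ is gap-rich.
   Context: A matrix $M\in\mathrm{SL}(2,\mathbb{R})$ is hyperbolic if $|\operatorname{trace}(M)|>2$. Analytic is meant in the sense of real-analytic maps between Banach spaces ($\mathrm{SL}(2,\mathbb{R})$ being viewed inside the $2\times 2$ real matrices). Let $(Y,d)$ be a complete metric space without isolated points (for a Banach space $X\neq\{0\}$, $d$ is the norm metric). A word over $Y$ is an element $\boldsymbol{x}=x_1x_2\cdots x_k$ of $Y^k$, $k\in\mathbb{N}=\{1,2,\ldots\}$; $Y^\star=\bigcup_{k\ge 1}Y^k$ is the set of all words. For a word $\boldsymbol{x}\in Y^k$, $\boldsymbol{x}^{\sharp\mathbb{Z}}\in Y^{\mathbb{Z}}$ denotes its $k$-periodic extension (coinciding with $\boldsymbol{x}$ on $\{1,\ldots,k\}$). For two words $\boldsymbol{x},\boldsymbol{y}\in Y^\star$, possibly of different lengths, $d(\boldsymbol{x},\boldsymbol{y}):=\sup_{j\in\mathbb{Z}}d\big((\boldsymbol{x}^{\sharp\mathbb{Z}})_j,(\boldsymbol{y}^{\sharp\mathbb{Z}})_j\big)$. A continuous map $A:Y\times\mathbb{R}\to\mathrm{SL}(2,\mathbb{R})$ is extended to $Y^\star\times\mathbb{R}$ by $A(x_1\cdots x_k,E)=A(x_k,E)\cdots A(x_2,E)A(x_1,E)$. $A$ is gap-rich with exceptional set $S\subseteq\mathbb{R}$ if $S$ is discrete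 and for all $E\in\mathbb{R}\setminus S$, $\boldsymbol{x}\in Y^\star$ and $\varepsilon>0$ there exists $\boldsymbol{y}\in Y^\star$ such that $d(\boldsymbol{x},\boldsymbol{y})<\varepsilon$ and $A(\boldsymbol{y},E)$ is hyperbolic. $A$ is non-ahyperbolic with exceptional set $S\subseteq\mathbb{R}$ if $S$ is discrete and for all $E\in\mathbb{R}\setminus S$ there exists some $y\in Y$ such that $A(y,E)$ is hyperbolic. "Gap-rich" (respectively "non-ahyperbolic") without mention of an exceptional set means with some discrete exceptional set $S$. *)

theory Defs
  imports "HOL-Analysis.Analysis"
begin

text \<open>Real-analytic maps between Banach spaces: near every point the map is the sum of a
  normally convergent power series of bounded multilinear maps.  An \<open>n\<close>-linear map is a function
  on lists, of which only the values on lists of length \<open>n\<close> matter.\<close>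

definition multilinear_map ::
    "nat \<Rightarrow> ('a::real_vector list \<Rightarrow> 'b::real_vector) \<Rightarrow> bool" where
  "multilinear_map n m \<longleftrightarrow>
     (\<forall>hs i. length hs = n \<and> i < n \<longrightarrow> linear (\<lambda>h. m (hs[i := h])))"

text \<open>\<open>c n\<close> is a bound for the norm of the \<open>n\<close>-linear map \<open>a n\<close>, so that boundedness is
  included.  Symmetry of the \<open>a n\<close> is not required; it can always be achieved by symmetrization,
  which does not increase the norm.\<close>

definition real_analytic_at ::
    "('a::banach \<Rightarrow> 'b::banach) \<Rightarrow> 'a \<Rightarrow> bool" where
  "real_analytic_at f x \<longleftrightarrow>
     (\<exists>(a :: nat \<Rightarrow> 'a list \<Rightarrow> 'b) (c :: nat \<Rightarrow> real) r.
        r > 0 \<and>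
        (\<forall>n. multilinear_map n (a n)) \<and>
        (\<forall>n hs. length hs = n \<longrightarrow> norm (a n hs) \<le> c n * prod_list (map norm hs)) \<and>
        summable (\<lambda>n. c n * r ^ n) \<and>
        (\<forall>h. norm h < r \<longrightarrow> (\<lambda>n. a n (replicate n h)) sums f (x + h)))"

definition real_analytic :: "('a::banach \<Rightarrow> 'b::banach) \<Rightarrow> bool" where
  "real_analytic f \<longleftrightarrow> (\<forall>x. real_analytic_at f x)"

definition SL2 :: "(real^2^2) set" where
  "SL2 = {M. det M = 1}"

definition hyperbolic :: "real^2^2 \<Rightarrow> bool" where
  "hyperbolic M \<longleftrightarrow> M \<in> SL2 \<and> \<bar>trace M\<bar> > 2"

definition words :: "'y list set" where
  "words = {xs. xs \<noteq> []}"

text \<open>Letters of a word are numbered from 1, whereas list positions are numbered from 0.\<close>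

definition periodic_ext :: "'y list \<Rightarrow> int \<Rightarrow> 'y" where
  "periodic_ext xs j = xs ! nat ((j - 1) mod int (length xs))"

text \<open>For nonempty words the supremum is over a finite set of values.\<close>

definition word_dist :: "'y::metric_space list \<Rightarrow> 'y list \<Rightarrow> real" where
  "word_dist xs ys = (SUP j. dist (periodic_ext xs j) (periodic_ext ys j))"

text \<open>The first letter acts first, i.e. it is the rightmost factor.\<close>

primrec word_product :: "('y \<times> real \<Rightarrow> real^2^2) \<Rightarrow> 'y list \<Rightarrow> real \<Rightarrow> real^2^2" where
  "word_product A [] E = mat 1"
| "word_product A (x # xs) E = word_product A xs E ** A (x, E)"

definition gap_rich_with ::
    "('y::complete_space \<times> real \<Rightarrow> real^2^2) \<Rightarrow> real set \<Rightarrow> bool" where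
  "gap_rich_with A S \<longleftrightarrow> discrete S \<and>
     (\<forall>E. E \<notin> S \<longrightarrow> (\<forall>x\<in>words. \<forall>\<epsilon>>0.
        \<exists>y\<in>words. word_dist x y < \<epsilon> \<and> hyperbolic (word_product A y E)))"

definition gap_rich :: "('y::complete_space \<times> real \<Rightarrow> real^2^2) \<Rightarrow> bool" where
  "gap_rich A \<longleftrightarrow> (\<exists>S. gap_rich_with A S)"

definition non_ahyperbolic_with ::
    "('y::complete_space \<times> real \<Rightarrow> real^2^2) \<Rightarrow> real set \<Rightarrow> bool" where
  "non_ahyperbolic_with A S \<longleftrightarrow> discrete S \<and>
     (\<forall>E. E \<notin> S \<longrightarrow> (\<exists>y. hyperbolic (A (y, E))))"

definition non_ahyperbolic :: "('y::complete_space \<times> real \<Rightarrow> real^2^2) \<Rightarrow> bool" where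
  "non_ahyperbolic A \<longleftrightarrow> (\<exists>S. non_ahyperbolic_with A S)"

end

theory Submission
  imports Defs "HOL-Complex_Analysis.Conformal_Mappings"
begin

text \<open>Fix \<open>E\<close> outside the exceptional set, a letter \<open>y\<close> with \<open>A (y, E)\<close> hyperbolic, and a word \<open>x\<close>.
  Let \<open>F t\<close> be the product along the word with letters \<open>x\<^sub>i + t (y - x\<^sub>i)\<close>; it is analytic in \<open>t\<close>, and
  \<open>F 1\<close> is hyperbolic. Suppose no product of values of \<open>F\<close> near \<open>0\<close> is hyperbolic. The trace of \<open>F\<close>
  is not constant near \<open>0\<close>, as otherwise \<open>F 1\<close> would not be hyperbolic, so some \<open>N = F t0\<close> with \<open>t0\<close>
  near \<open>0\<close> is conjugate to a rotation by an irrational angle. Since the traces of \<open>N\<^sup>n F t\<close> are bounded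
  by \<open>2\<close> for all \<open>n\<close>, density of the rotation orbit gives \<open>tr [N, F t] \<le> 2\<close>. The reverse inequality
  holds in general for elliptic \<open>N\<close>, hence \<open>tr [N, F t] = 2\<close> near \<open>0\<close>, and by analyticity for all \<open>t\<close>.
  At \<open>t = 1\<close> this forces the trace of \<open>F 1\<close> into \<open>[-2, 2]\<close>, a contradiction.
  The same exceptional set works for both properties.\<close>

section \<open>Real functions with local holomorphic extensions\<close>

text \<open>Real-analyticity on the line, encoded so that sums, products and the identity theorem
  are inherited from holomorphic functions. The extension \<open>G\<close> may change with
  \<open>t\<close>.\<close>

definition complexifiable :: "(real \<Rightarrow> real) \<Rightarrow> bool" where
  "complexifiable g \<longleftrightarrow> (\<forall>t. \<exists>G. G analytic_on {complex_of_real t} \<and>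
     (\<forall>\<^sub>F s in nhds t. G (of_real s) = of_real (g s)))"

lemma complexifiable_const: "complexifiable (\<lambda>_. c)"
  unfolding complexifiable_def
  by (intro allI exI[of _ "\<lambda>_. of_real c"]) auto

lemma complexifiable_add:
  assumes "complexifiable f" "complexifiable g"
  shows "complexifiable (\<lambda>t. f t + g t)"
  unfolding complexifiable_def
proof
  fix t
  obtain F G where *: "F analytic_on {complex_of_real t}" "G analytic_on {complex_of_real t}"
    "\<forall>\<^sub>F s in nhds t. F (of_real s) = of_real (f s)"
    "\<forall>\<^sub>F s in nhds t. G (of_real s) = of_real (g s)"
    using assms unfolding complexifiable_def by metis
  show "\<exists>H. H analytic_on {complex_of_real t} \<and>
      (\<forall>\<^sub>F s in nhds t. H (of_real s) = of_real (f s + g s))"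
    by (intro exI[of _ "\<lambda>z. F z + G z"] conjI analytic_intros *
        eventually_elim2[OF *(3,4)]) auto
qed

lemma complexifiable_mult:
  assumes "complexifiable f" "complexifiable g"
  shows "complexifiable (\<lambda>t. f t * g t)"
  unfolding complexifiable_def
proof
  fix t
  obtain F G where *: "F analytic_on {complex_of_real t}" "G analytic_on {complex_of_real t}"
    "\<forall>\<^sub>F s in nhds t. F (of_real s) = of_real (f s)"
    "\<forall>\<^sub>F s in nhds t. G (of_real s) = of_real (g s)"
    using assms unfolding complexifiable_def by metis
  show "\<exists>H. H analytic_on {complex_of_real t} \<and>
      (\<forall>\<^sub>F s in nhds t. H (of_real s) = of_real (f s * g s))"
    by (intro exI[of _ "\<lambda>z. F z * G z"] conjI analytic_intros *
        eventually_elim2[OF *(3,4)]) auto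
qed

lemma complexifiable_sum:
  "(\<And>i. i \<in> I \<Longrightarrow> complexifiable (f i)) \<Longrightarrow> complexifiable (\<lambda>t. \<Sum>i\<in>I. f i t)"
  by (induction I rule: infinite_finite_induct)
    (simp_all add: complexifiable_const complexifiable_add)

lemma complexifiable_isCont:
  assumes "complexifiable g"
  shows "isCont g t"
proof -
  obtain G where G: "G analytic_on {complex_of_real t}"
    "\<forall>\<^sub>F s in nhds t. G (of_real s) = of_real (g s)"
    using assms unfolding complexifiable_def by metis
  have "isCont (\<lambda>s. G (complex_of_real s)) t"
    by (rule isCont_o2) (use analytic_at_imp_isCont[OF G(1)] in auto)
  then have "isCont (\<lambda>s. Re (G (complex_of_real s))) t"
    by (rule continuous_Re)
  moreover have "\<forall>\<^sub>F s in nhds t. Re (G (of_real s)) = g s"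
    using G(2) by eventually_elim simp
  ultimately show ?thesis
    using isCont_cong[of "\<lambda>s. Re (G (of_real s))" g t] by simp
qed

text \<open>The same coefficients give a complex power series: real convergence at some
  \<open>s\<close> strictly between \<open>cmod (z - of_real t)\<close> and \<rho> forces
  convergence at \<open>z\<close>.\<close>

lemma complexifiable_powser:
  fixes g :: "real \<Rightarrow> real"
  assumes "\<And>t. \<exists>\<rho>>0. \<exists>b. \<forall>s. \<bar>s\<bar> < \<rho> \<longrightarrow> (\<lambda>n. b n * s ^ n) sums g (t + s)"
  shows "complexifiable g"
  unfolding complexifiable_def
proof
  fix t
  obtain \<rho> b where \<rho>: "\<rho> > 0" and b: "\<And>s. \<bar>s\<bar> < \<rho> \<Longrightarrow> (\<lambda>n. b n * s ^ n) sums g (t + s)"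
    using assms by blast
  define G where "G z = (\<Sum>n. complex_of_real (b n) * (z - of_real t) ^ n)" for z
  have "(\<lambda>n. complex_of_real (b n) * (z - of_real t) ^ n) sums G z"
    if z: "z \<in> ball (of_real t) \<rho>" for z
  proof -
    obtain s where s: "cmod (z - of_real t) < s" "s < \<rho>"
      using z dense by (auto simp: dist_norm norm_minus_commute)
    then have "0 < s"
      using norm_ge_zero le_less_trans by blast
    then have "summable (\<lambda>n. b n * s ^ n)"
      using b[of s] s sums_summable by simp
    then have "summable (\<lambda>n. complex_of_real (b n * s ^ n))"
      by (rule summable_of_real)
    then have "summable (\<lambda>n. complex_of_real (b n) * of_real s ^ n)"
      by simp
    then have "summable (\<lambda>n. complex_of_real (b n) * (z - of_real t) ^ n)"
      by (rule powser_inside) (use s \<open>0 < s\<close> in simp)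
    then show ?thesis
      unfolding G_def by (rule summable_sums)
  qed
  then have "G analytic_on ball (of_real t) \<rho>"
    by (rule power_series_analytic)
  then have "G analytic_on {of_real t}"
    by (rule analytic_on_subset) (use \<rho> in auto)
  moreover have "G (of_real s) = of_real (g s)" if "s \<in> ball t \<rho>" for s
  proof -
    have "(\<lambda>n. b n * (s - t) ^ n) sums g s"
      using b[of "s - t"] that by (simp add: dist_real_def abs_minus_commute)
    then have "(\<lambda>n. complex_of_real (b n * (s - t) ^ n)) sums of_real (g s)"
      by (rule sums_of_real)
    then show ?thesis
      unfolding G_def by (intro sums_unique[symmetric]) simp
  qed
  then have "\<forall>\<^sub>F s in nhds t. G (of_real s) = of_real (g s)"
    unfolding eventually_nhds using \<rho> by (intro exI[of _ "ball t \<rho>"]) auto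
  ultimately show "\<exists>G. G analytic_on {complex_of_real t} \<and>
      (\<forall>\<^sub>F s in nhds t. G (of_real s) = of_real (g s))"
    by blast
qed

text \<open>The set \<open>T\<close> of points near which \<open>g\<close> equals \<open>c\<close>
  is open, is closed by the identity theorem for holomorphic functions, and contains 0, so it is the
  whole line.\<close>

lemma complexifiable_identity:
  assumes g: "complexifiable g" and \<delta>: "\<delta> > 0" and eq: "\<And>t. \<bar>t\<bar> < \<delta> \<Longrightarrow> g t = c"
  shows "g t = c"
proof -
  define T where "T = {t. \<forall>\<^sub>F s in nhds t. g s = c}"
  have "open T"
    unfolding T_def by (subst open_subopen) (auto simp: eventually_nhds)
  have "closure T \<subseteq> T"
  proof
    fix t assume t: "t \<in> closure T"
    obtain G where G: "G analytic_on {complex_of_real t}"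
      "\<forall>\<^sub>F s in nhds t. G (of_real s) = of_real (g s)"
      using g unfolding complexifiable_def by metis
    obtain e1 where e1: "e1 > 0" "G holomorphic_on ball (of_real t) e1"
      using G(1) unfolding analytic_at_ball by blast
    obtain e2 where e2: "e2 > 0" "\<And>s. dist s t < e2 \<Longrightarrow> G (of_real s) = of_real (g s)"
      using G(2) unfolding eventually_nhds_metric by blast
    define e where "e = min e1 e2"
    have "e > 0"
      using e1 e2 by (simp add: e_def)
    then obtain u where u: "u \<in> T" "dist u t < e"
      using t closure_approachable by blast
    have holo: "G holomorphic_on ball (of_real t) e"
      using e1(2) by (rule holomorphic_on_subset) (auto simp: e_def)
    obtain d0 where d0: "d0 > 0" "\<And>s. dist s u < d0 \<Longrightarrow> g s = c"
      using u(1) unfolding T_def eventually_nhds_metric by blast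
    \<comment> \<open>On \<open>ball u d\<close> the value of \<open>g\<close> is \<open>c\<close>,
      and the ball stays inside \<open>ball t e\<close>, where \<open>G\<close> extends
      \<open>g\<close>.\<close>
    define d where "d = min d0 (e - dist u t)"
    have "d > 0"
      using d0 u by (simp add: d_def)
    let ?U = "complex_of_real ` ball u d"
    have near: "s \<in> ball t e" if "s \<in> ball u d" for s
      using that dist_triangle[of s t u] by (simp add: d_def dist_commute)
    have "G z - of_real c = 0" if "z \<in> ball (of_real t) e" for z
    proof (rule analytic_continuation[of "\<lambda>z. G z - of_real c" "ball (of_real t) e" ?U "of_real u"])
      show "?U \<subseteq> ball (of_real t) e"
        using near by auto
      show "complex_of_real u \<in> ball (of_real t) e"
        using u by (simp add: dist_commute)
      have "u islimpt ball u d"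
        using \<open>d > 0\<close> by (simp add: islimpt_ball)
      then show "complex_of_real u islimpt ?U"
        by (rule islimpt_isCont_image) (auto simp: eventually_at_filter)
      fix w assume "w \<in> ?U"
      then obtain s where s: "w = of_real s" "s \<in> ball u d"
        by blast
      moreover have "dist s t < e2" "dist s u < d0"
        using near[OF s(2)] s(2) by (auto simp: e_def d_def dist_commute)
      ultimately show "G w - of_real c = 0"
        using e2(2) d0(2) by simp
    qed (use that in \<open>auto intro!: holomorphic_intros holo\<close>)
    then have "g s = c" if "dist s t < e" for s
      using that e2(2)[of s] by (simp add: e_def dist_commute)
    then show "t \<in> T"
      unfolding T_def eventually_nhds_metric using \<open>e > 0\<close> by blast
  qed
  then have "closed T"
    using closure_subset_eq by blast
  moreover have "0 \<in> T"
    unfolding T_def eventually_nhds_metric using \<delta> eq by auto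
  ultimately have "T = UNIV"
    using \<open>open T\<close> clopen by blast
  then have "t \<in> T"
    by simp
  then show ?thesis
    unfolding T_def using eventually_nhds_x_imp_x by blast
qed

section \<open>Restriction of analytic maps to lines\<close>

lemma multilinear_map_replicate_scaleR:
  assumes "multilinear_map n m"
  shows "m (replicate n (s *\<^sub>R v)) = s ^ n *\<^sub>R m (replicate n v)"
proof -
  \<comment> \<open>The entries are scaled one at a time; \<open>k\<close> counts those already
    scaled.\<close>
  have "m (replicate k (s *\<^sub>R v) @ replicate (n - k) v) = s ^ k *\<^sub>R m (replicate n v)"
    if "k \<le> n" for k
    using that
  proof (induction k)
    case (Suc k)
    let ?hs = "replicate k (s *\<^sub>R v) @ replicate (n - k) v"
    have split: "replicate (n - k) v = v # replicate (n - Suc k) v"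
      using Suc.prems by (metis Suc_diff_le diff_Suc_Suc replicate_Suc)
    have "linear (\<lambda>h. m (?hs[k := h]))"
      using assms Suc.prems unfolding multilinear_map_def by simp
    then have "m (?hs[k := s *\<^sub>R v]) = s *\<^sub>R m (?hs[k := v])"
      by (rule linear_scale)
    moreover have "?hs[k := s *\<^sub>R v] = replicate (Suc k) (s *\<^sub>R v) @ replicate (n - Suc k) v"
      unfolding split by (simp add: list_update_append replicate_app_Cons_same)
    moreover have "?hs[k := v] = ?hs"
      unfolding split by (simp add: list_update_append)
    ultimately show ?case
      using Suc by simp
  qed simp
  from this[of n] show ?thesis
    by simp
qed

text \<open>By homogeneity the \<open>n\<close>-th term at \<open>s *\<^sub>R v\<close> is
  \<open>s ^ n\<close> times its value at \<open>v\<close>, which leaves an ordinary power series in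
  \<open>s\<close>.\<close>

lemma real_analytic_line_complexifiable:
  fixes f :: "'a::banach \<Rightarrow> 'b::banach" and \<phi> :: "'b \<Rightarrow> real"
  assumes "real_analytic f" and \<phi>: "bounded_linear \<phi>"
  shows "complexifiable (\<lambda>t. \<phi> (f (p + t *\<^sub>R v)))"
proof (rule complexifiable_powser)
  fix t
  obtain a r where r: "r > 0" and a: "\<And>n. multilinear_map n (a n)"
    and sums: "\<And>h. norm h < r \<Longrightarrow> (\<lambda>n. a n (replicate n h)) sums f (p + t *\<^sub>R v + h)"
    using assms(1) unfolding real_analytic_def real_analytic_at_def by metis
  have "(\<lambda>n. \<phi> (a n (replicate n v)) * s ^ n) sums \<phi> (f (p + (t + s) *\<^sub>R v))"
    \<comment> \<open>The \<open>+ 1\<close> covers the case \<open>v = 0\<close>.\<close>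
    if s: "\<bar>s\<bar> < r / (norm v + 1)" for s
  proof -
    have "\<bar>s\<bar> * norm v \<le> \<bar>s\<bar> * (norm v + 1)"
      by (simp add: mult_left_mono)
    also have "\<dots> < r"
      using s by (simp add: pos_less_divide_eq add_nonneg_pos)
    finally have "norm (s *\<^sub>R v) < r"
      by simp
    from bounded_linear.sums[OF \<phi> sums[OF this]] show ?thesis
      by (simp add: multilinear_map_replicate_scaleR[OF a] linear_scale bounded_linear.linear[OF \<phi>]
          scaleR_add_left add.assoc mult.commute)
  qed
  moreover have "r / (norm v + 1) > 0"
    using r by (simp add: add_nonneg_pos)
  ultimately show "\<exists>\<rho>>0. \<exists>b. \<forall>s. \<bar>s\<bar> < \<rho> \<longrightarrow>
      (\<lambda>n. b n * s ^ n) sums \<phi> (f (p + (t + s) *\<^sub>R v))"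
    by (intro exI[of _ "r / (norm v + 1)"] conjI
        exI[of _ "\<lambda>n. \<phi> (a n (replicate n v))"]) simp_all
qed

section \<open>Words\<close>

lemma nth_concat_equal_length:
  assumes "\<And>w. w \<in> set ws \<Longrightarrow> length w = k" "i < length ws * k"
  shows "concat ws ! i = ws ! (i div k) ! (i mod k)"
  using assms
proof (induction ws arbitrary: i)
  case (Cons w ws)
  show ?case
  proof (cases "i < k")
    case True
    then show ?thesis
      using Cons.prems(1)[of w] by (simp add: nth_append)
  next
    case False
    then obtain j where j: "i = k + j"
      using le_Suc_ex not_less by blast
    have "k > 0"
      using Cons.prems(2) by (cases k) auto
    then show ?thesis
      using Cons j by (simp add: nth_append)
  qed
qed simp

text \<open>Blocks as long as \<open>x\<close> keep the periodic extensions aligned: each letter of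
  the concatenation is compared with the letter of \<open>x\<close> at the same place in its
  block.\<close>

lemma word_dist_concat_le:
  fixes x :: "'y::metric_space list"
  assumes "ws \<noteq> []" "x \<noteq> []"
    and len: "\<And>w. w \<in> set ws \<Longrightarrow> length w = length x"
    and d: "\<And>w i. w \<in> set ws \<Longrightarrow> i < length x \<Longrightarrow> dist (x ! i) (w ! i) \<le> \<eta>"
  shows "word_dist x (concat ws) \<le> \<eta>"
  unfolding word_dist_def
proof (rule cSUP_least)
  fix j :: int
  let ?k = "length x"
  have lc: "length (concat ws) = length ws * ?k"
    using len by (induction ws) auto
  define m where "m = nat ((j - 1) mod int (length ws * ?k))"
  have m: "m < length ws * ?k"
    using assms(1,2) unfolding m_def by (simp add: nat_less_iff)
  have "int m = (j - 1) mod int (length ws * ?k)"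
    using assms(1,2) unfolding m_def by simp
  then have "int (m mod ?k) = (j - 1) mod int ?k"
    by (simp add: zmod_int mod_mod_cancel)
  then have mm: "nat ((j - 1) mod int ?k) = m mod ?k"
    by linarith
  have "m div ?k < length ws"
    using m by (simp add: less_mult_imp_div_less)
  then have "dist (x ! (m mod ?k)) (ws ! (m div ?k) ! (m mod ?k)) \<le> \<eta>"
    using assms(2) by (intro d) auto
  then show "dist (periodic_ext x j) (periodic_ext (concat ws) j) \<le> \<eta>"
    unfolding periodic_ext_def lc mm m_def[symmetric]
    using nth_concat_equal_length[OF len m] by simp
qed simp

lemma word_product_append:
  "word_product A (xs @ ys) E = word_product A ys E ** word_product A xs E"
  by (induction xs) (simp_all add: matrix_mul_assoc)

lemma word_product_append_replicate:
  "word_product A (xs @ concat (replicate n ys)) E =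
     ((**) (word_product A ys E) ^^ n) (word_product A xs E)"
proof (induction n arbitrary: xs)
  case (Suc n)
  from Suc[of "xs @ ys"] show ?case
    by (simp add: word_product_append funpow_swap1)
qed simp

lemma word_product_in_SL2:
  assumes "\<forall>p. A p \<in> SL2"
  shows "word_product A xs E \<in> SL2"
  using assms by (induction xs) (auto simp: SL2_def det_mul)

section \<open>Traces in SL(2)\<close>

lemma trace_2: "trace (M :: real^2^2) = M$1$1 + M$2$2"
  by (simp add: trace_def sum_2)

lemma trace_mult_2:
  fixes M N :: "real^2^2"
  shows "trace (N ** M) = N$1$1 * M$1$1 + N$1$2 * M$2$1 + N$2$1 * M$1$2 + N$2$2 * M$2$2"
  by (simp add: trace_def sum_2 matrix_matrix_mult_def)

text \<open>Cayley-Hamilton, multiplied by \<open>M\<close> and traced; it yields a two-step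
  recurrence for the traces of the powers of \<open>N\<close> times \<open>M\<close>.\<close>

lemma trace_Cayley_Hamilton:
  fixes N M :: "real^2^2"
  assumes "det N = 1"
  shows "trace (N ** (N ** M)) = trace N * trace (N ** M) - trace M"
proof -
  have "trace (N ** (N ** M)) = trace N * trace (N ** M) - det N * trace M"
    by (simp add: trace_def sum_2 matrix_matrix_mult_def det_2) algebra
  then show ?thesis
    using assms by simp
qed

text \<open>Both sides satisfy the recurrence with characteristic roots of angle \<theta> and
  -\<theta>; the coefficient of the sine is fitted at \<open>n = 1\<close>.\<close>

lemma trace_funpow_elliptic:
  fixes N M :: "real^2^2"
  assumes "det N = 1" and tr: "trace N = 2 * cos \<theta>" and s: "sin \<theta> \<noteq> 0"
  shows "trace (((**) N ^^ n) M) = cos (real n * \<theta>) * trace M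
     + sin (real n * \<theta>) * ((trace (N ** M) - cos \<theta> * trace M) / sin \<theta>)"
proof (induction n rule: induct_nat_012)
  case (ge2 n)
  let ?\<beta> = "(trace (N ** M) - cos \<theta> * trace M) / sin \<theta>"
  let ?P = "\<lambda>n. ((**) N ^^ n) M"
  have "cos (real (Suc (Suc n)) * \<theta>) = 2 * cos \<theta> * cos (real (Suc n) * \<theta>) - cos (real n * \<theta>)"
    "sin (real (Suc (Suc n)) * \<theta>) = 2 * cos \<theta> * sin (real (Suc n) * \<theta>) - sin (real n * \<theta>)"
    using cos_add[of "real (Suc n) * \<theta>" \<theta>] cos_diff[of "real (Suc n) * \<theta>" \<theta>]
      sin_add[of "real (Suc n) * \<theta>" \<theta>] sin_diff[of "real (Suc n) * \<theta>" \<theta>]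
    by (simp_all add: algebra_simps)
  moreover have "trace (?P (Suc (Suc n))) = 2 * cos \<theta> * trace (?P (Suc n)) - trace (?P n)"
    using trace_Cayley_Hamilton[OF assms(1), of "?P n"] tr by simp
  ultimately show ?case
    by (simp only: ge2 ring_distribs mult.assoc)
qed (use s in \<open>simp_all\<close>)

text \<open>The recurrence makes the absolute traces of the powers convex. They start at 2 and first
  increase strictly, so they never come back down to 2.\<close>

lemma trace_funpow_hyperbolic:
  fixes N :: "real^2^2"
  assumes "det N = 1" and tr: "\<bar>trace N\<bar> > 2"
  shows "\<bar>trace (((**) N ^^ Suc n) (mat 1))\<bar> > 2"
proof -
  define u where "u n = \<bar>trace (((**) N ^^ n) (mat 1))\<bar>" for n
  have "u n \<le> u (Suc n) \<and> u (Suc n) > 2" for n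
  proof (induction n)
    case 0
    then show ?case
      using tr by (simp add: u_def trace_I)
  next
    case (Suc n)
    have "2 * u (Suc n) \<le> \<bar>trace N\<bar> * u (Suc n)"
      using tr by (intro mult_right_mono) (auto simp: u_def)
    also have "\<dots> \<le> u (Suc (Suc n)) + u n"
      using trace_Cayley_Hamilton[OF assms(1), of "((**) N ^^ n) (mat 1)"]
      by (simp add: u_def abs_mult[symmetric])
    finally show ?case
      using Suc by linarith
  qed
  then show ?thesis
    unfolding u_def by blast
qed

text \<open>The Fricke polynomial \<open>tr[N, M] - 2\<close>, in terms of traces of \<open>N\<close>, \<open>M\<close> and \<open>NM\<close>.\<close>

definition fricke :: "real^2^2 \<Rightarrow> real^2^2 \<Rightarrow> real" where
  "fricke N M = (trace M)\<^sup>2 + (trace (N ** M))\<^sup>2 + (trace N)\<^sup>2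
     - trace N * trace M * trace (N ** M) - 4"

text \<open>Ellipticity of \<open>N\<close> makes \<open>- (b * c)\<close> positive, and
  multiplication by it turns the Fricke polynomial into a sum of squares.\<close>

lemma fricke_nonneg:
  fixes N M :: "real^2^2"
  assumes "det N = 1" "det M = 1" "\<bar>trace N\<bar> < 2"
  shows "fricke N M \<ge> 0"
proof -
  define a b c d e f g h where abcd: "a = N$1$1" "b = N$1$2" "c = N$2$1" "d = N$2$2"
    "e = M$1$1" "f = M$1$2" "g = M$2$1" "h = M$2$2"
  \<comment> \<open>\<open>s2\<close> is the squared sine of the rotation angle of
    \<open>N\<close>.\<close>
  define p s2 u where pu: "p = (a - d) / 2" "s2 = 1 - (a + d)\<^sup>2 / 4" "u = e - h"
  have "(a + d)\<^sup>2 < 2\<^sup>2"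
    using assms(3) unfolding abcd trace_2 by (metis abs_ge_zero power2_abs power_strict_mono pos2)
  then have s2: "s2 > 0"
    by (simp add: pu)
  have dets: "a * d - b * c = 1" "e * h - f * g = 1"
    using assms(1,2) by (simp_all add: det_2 abcd)
  then have bc: "- (b * c) = p\<^sup>2 + s2"
    unfolding pu by (simp add: power2_eq_square field_simps)
  have X: "fricke N M = (p * u + b * g + c * f)\<^sup>2 + s2 * (u\<^sup>2 + 4 * f * g)"
  proof -
    have "fricke N M = (p * u + b * g + c * f)\<^sup>2 + s2 * ((e + h)\<^sup>2 - 4)"
      unfolding fricke_def trace_mult_2 unfolding trace_2 abcd[symmetric] pu
      by (simp add: power2_eq_square field_simps)
    moreover have "(e + h)\<^sup>2 - 4 = u\<^sup>2 + 4 * f * g"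
      using dets(2) unfolding pu by algebra
    ultimately show ?thesis
      by simp
  qed
  \<comment> \<open>The square is completed in \<open>u\<close>; replacing
    \<open>p\<^sup>2 + s2\<close> by \<open>- (b * c)\<close> makes the remainder a square
    too.\<close>
  have "(p\<^sup>2 + s2) * fricke N M =
      ((p\<^sup>2 + s2) * u + p * (b * g + c * f))\<^sup>2 + s2 * (b * g - c * f)\<^sup>2"
    using bc unfolding X by algebra
  also have "\<dots> \<ge> 0"
    using s2 by simp
  finally have "0 \<le> (p\<^sup>2 + s2) * fricke N M" .
  moreover have "p\<^sup>2 + s2 > 0"
    using s2 by (simp add: add_nonneg_pos)
  ultimately show ?thesis
    by (simp add: zero_le_mult_iff)
qed

text \<open>Completion of the square in \<open>trace (N ** M)\<close>. For elliptic \<open>N\<close>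
  the coefficient of the last term is positive, so a nonpositive value bounds the trace of
  \<open>M\<close>.\<close>

lemma fricke_eq:
  "fricke N M = (trace (N ** M) - trace N / 2 * trace M)\<^sup>2
     + (1 - (trace N / 2)\<^sup>2) * ((trace M)\<^sup>2 - 4)"
  unfolding fricke_def by (simp add: power2_eq_square field_simps)

lemma abs_trace_le_2_if_fricke_nonpos:
  assumes "fricke N M \<le> 0" "\<bar>trace N\<bar> < 2"
  shows "\<bar>trace M\<bar> \<le> 2"
proof -
  have "\<bar>trace N / 2\<bar> < 1"
    using assms(2) by simp
  then have "1 - (trace N / 2)\<^sup>2 > 0"
    by (simp add: abs_square_less_1)
  moreover have "(1 - (trace N / 2)\<^sup>2) * ((trace M)\<^sup>2 - 4) \<le> 0"
    using assms(1) zero_le_power2[of "trace (N ** M) - trace N / 2 * trace M"]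
    unfolding fricke_eq by linarith
  ultimately have "(trace M)\<^sup>2 \<le> 2\<^sup>2"
    by (simp add: mult_le_0_iff)
  then show ?thesis
    using abs_le_square_iff[of "trace M" 2] by simp
qed

section \<open>Irrational rotations\<close>

text \<open>In polar form the orbit values are \<open>R * cos (real n * \<theta> - \<phi>)\<close>.
  Multiples of \<theta> are dense modulo \<open>2 * pi\<close>, so the values come arbitrarily close
  to \<open>R\<close>.\<close>

lemma cos_sin_orbit_bound:
  fixes \<alpha> \<beta> \<theta> C :: real
  assumes irr: "\<theta> / (2 * pi) \<notin> \<rat>" and "C \<ge> 0"
    and bound: "\<And>n. \<bar>cos (real n * \<theta>) * \<alpha> + sin (real n * \<theta>) * \<beta>\<bar> \<le> C"
  shows "\<alpha>\<^sup>2 + \<beta>\<^sup>2 \<le> C\<^sup>2"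
proof (rule ccontr)
  assume neg: "\<not> ?thesis"
  define R where "R = sqrt (\<alpha>\<^sup>2 + \<beta>\<^sup>2)"
  have R: "R > C"
    using neg \<open>C \<ge> 0\<close> unfolding R_def by (simp add: real_less_rsqrt)
  then have "R > 0"
    using \<open>C \<ge> 0\<close> by simp
  have "R\<^sup>2 = \<alpha>\<^sup>2 + \<beta>\<^sup>2"
    by (simp add: R_def)
  then have "(\<alpha> / R)\<^sup>2 + (\<beta> / R)\<^sup>2 = 1"
    using \<open>R > 0\<close> by (simp add: power_divide flip: add_divide_distrib \<open>R\<^sup>2 = _\<close>)
  then obtain \<phi> where \<phi>: "\<alpha> / R = cos \<phi>" "\<beta> / R = sin \<phi>"
    using sincos_total_2pi by metis
  have "(cos \<longlongrightarrow> 1) (nhds (0::real))"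
    using tendsto_cos[OF filterlim_ident[of "nhds (0::real)"]] by simp
  then have "\<forall>\<^sub>F x in nhds (0::real). cos x > C / R"
    using R \<open>R > 0\<close> by (intro order_tendstoD) auto
  then obtain e where e: "e > 0" "\<And>x::real. \<bar>x\<bar> < e \<Longrightarrow> cos x > C / R"
    unfolding eventually_nhds_metric by (auto simp: dist_real_def)
  \<comment> \<open>Density is applied in units of a full turn; positivity of \<open>k\<close> lets
    it serve as an exponent.\<close>
  obtain h k :: int where hk: "k > 0" "\<bar>of_int k * (\<theta> / (2 * pi)) - of_int h - \<phi> / (2 * pi)\<bar> < e / (2 * pi)"
    using sequence_of_fractional_parts_is_dense[OF irr, of "e / (2 * pi)"] e(1)
    by (metis divide_pos_pos mult_pos_pos pi_gt_zero zero_less_numeral)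
  define n where "n = nat k"
  have n: "of_int k = real n"
    using hk(1) by (simp add: n_def)
  define x where "x = real n * \<theta> - \<phi> - 2 * pi * of_int h"
  have "x / (2 * pi) = of_int k * (\<theta> / (2 * pi)) - of_int h - \<phi> / (2 * pi)"
    unfolding n x_def by (simp add: field_simps)
  then have "\<bar>x / (2 * pi)\<bar> < e / (2 * pi)"
    using hk(2) by simp
  then have "\<bar>x\<bar> < e"
    by (simp add: divide_less_cancel)
  then have "C / R < cos x"
    by (rule e(2))
  also have "cos x = cos (real n * \<theta> - \<phi>)"
    unfolding x_def cos_diff[of "real n * \<theta> - \<phi>"] by simp
  finally have "C < R * cos (real n * \<theta> - \<phi>)"
    using \<open>R > 0\<close> by (simp add: field_simps)
  also have "\<dots> = cos (real n * \<theta>) * (R * cos \<phi>) + sin (real n * \<theta>) * (R * sin \<phi>)"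
    by (simp add: cos_diff algebra_simps)
  also have "\<dots> = cos (real n * \<theta>) * \<alpha> + sin (real n * \<theta>) * \<beta>"
    unfolding \<phi>[symmetric] using \<open>R > 0\<close> by simp
  finally show False
    using bound[of n] by linarith
qed

text \<open>The orbit bound says that the squared amplitude of the trace sequence is at most 4;
  multiplied by the squared sine of \<theta>, this is the claim.\<close>

lemma fricke_nonpos_if_bounded_orbit:
  fixes N M :: "real^2^2"
  assumes "det N = 1" "trace N = 2 * cos \<theta>" and irr: "\<theta> / (2 * pi) \<notin> \<rat>"
    and bound: "\<And>n. \<bar>trace (((**) N ^^ n) M)\<bar> \<le> 2"
  shows "fricke N M \<le> 0"
proof -
  have s: "sin \<theta> \<noteq> 0"
  proof
    assume "sin \<theta> = 0"
    then obtain i :: int where "\<theta> = of_int i * pi"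
      using sin_zero_iff_int2 by blast
    then have "\<theta> / (2 * pi) = of_int i / 2"
      by simp
    then show False
      using irr by (metis Rats_divide Rats_number_of Rats_of_int)
  qed
  let ?\<beta> = "(trace (N ** M) - cos \<theta> * trace M) / sin \<theta>"
  have "(trace M)\<^sup>2 + ?\<beta>\<^sup>2 \<le> 2\<^sup>2"
    by (rule cos_sin_orbit_bound[OF irr])
      (use bound trace_funpow_elliptic[OF assms(1,2) s] in simp_all)
  then have "(sin \<theta>)\<^sup>2 * ((trace M)\<^sup>2 + ?\<beta>\<^sup>2 - 4) \<le> 0"
    by (simp add: mult_nonneg_nonpos)
  moreover have "(sin \<theta>)\<^sup>2 * ?\<beta>\<^sup>2 = (trace (N ** M) - cos \<theta> * trace M)\<^sup>2"
    using s by (simp add: power_divide)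
  moreover have "(sin \<theta>)\<^sup>2 = 1 - (trace N / 2)\<^sup>2"
    by (simp add: assms(2) sin_squared_eq)
  ultimately show ?thesis
    unfolding fricke_eq assms(2) by (simp add: algebra_simps)
qed

text \<open>Rational angles give only countably many traces, whereas an interval is
  uncountable.\<close>

lemma exists_irrational_angle:
  fixes a b :: real
  assumes "a < b" "- 2 \<le> a" "b \<le> 2"
  obtains \<theta> where "a < 2 * cos \<theta>" "2 * cos \<theta> < b" "\<theta> / (2 * pi) \<notin> \<rat>"
proof -
  let ?Q = "(\<lambda>q. 2 * cos (2 * pi * q)) ` \<rat>"
  have "countable ?Q"
    by (simp add: countable_rat)
  then have "\<not> {a<..<b} \<subseteq> ?Q"
    using uncountable_open_interval assms(1) countable_subset by blast
  then obtain v where v: "a < v" "v < b" "v \<notin> ?Q"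
    by (meson greaterThanLessThan_iff subsetI)
  define \<theta> where "\<theta> = arccos (v / 2)"
  have c: "2 * cos \<theta> = v"
    using v assms unfolding \<theta>_def by simp
  have "\<theta> / (2 * pi) \<notin> \<rat>"
  proof
    assume "\<theta> / (2 * pi) \<in> \<rat>"
    then have "2 * cos (2 * pi * (\<theta> / (2 * pi))) \<in> ?Q"
      by blast
    then show False
      using v(3) c by simp
  qed
  then show thesis
    using that v c by blast
qed

section \<open>Density of hyperbolic words\<close>

lemma fricke_complexifiable:
  assumes F: "\<And>i j. complexifiable (\<lambda>t. F t $ i $ j)"
  shows "complexifiable (\<lambda>t. fricke N (F t))"
proof -
  have tr: "complexifiable (\<lambda>t. trace (F t))"
    unfolding trace_2 by (intro complexifiable_add F)
  have trN: "complexifiable (\<lambda>t. trace (N ** F t))"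
    unfolding trace_mult_2
    by (intro complexifiable_add complexifiable_mult complexifiable_const F)
  have eq: "fricke N M = trace M * trace M + trace (N ** M) * trace (N ** M)
      + ((trace N)\<^sup>2 - 4 + (- trace N) * (trace M * trace (N ** M)))" for M
    unfolding fricke_def by (simp add: power2_eq_square algebra_simps)
  show ?thesis
    unfolding eq
    by (intro complexifiable_add complexifiable_mult complexifiable_const tr trN)
qed

text \<open>Hyperbolicity at a possibly distant \<open>t1\<close> is felt near 0 because both the
  trace and the Fricke polynomial along the curve obey the identity theorem.\<close>

lemma curve_hyperbolic_semigroup:
  fixes F :: "real \<Rightarrow> real^2^2"
  assumes F: "\<And>i j. complexifiable (\<lambda>t. F t $ i $ j)"
    and det: "\<And>t. det (F t) = 1"
    and hyp: "\<bar>trace (F t1)\<bar> > 2" and \<delta>: "\<delta> > 0"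
  shows "\<exists>t0 t n. \<bar>t0\<bar> < \<delta> \<and> \<bar>t\<bar> < \<delta> \<and> \<bar>trace (((**) (F t0) ^^ n) (F t))\<bar> > 2"
proof (rule ccontr)
  assume neg: "\<not> ?thesis"
  then have bound: "\<bar>trace (((**) (F t0) ^^ n) (F t))\<bar> \<le> 2" if "\<bar>t0\<bar> < \<delta>" "\<bar>t\<bar> < \<delta>" for t0 t n
    using that not_le by blast
  then have bound1: "\<bar>trace (F t)\<bar> \<le> 2" if "\<bar>t\<bar> < \<delta>" for t
    using that bound[of t t 0] by simp
  have tr: "complexifiable (\<lambda>t. trace (F t))"
    unfolding trace_2 by (intro complexifiable_add F)
  have "\<exists>u. \<bar>u\<bar> < \<delta> \<and> trace (F u) \<noteq> trace (F 0)"
  proof (rule ccontr)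
    assume "\<not> ?thesis"
    then have "trace (F t1) = trace (F 0)"
      using complexifiable_identity[OF tr \<delta>] by metis
    then show False
      using hyp bound1[of 0] \<delta> by simp
  qed
  then obtain u where u: "\<bar>u\<bar> < \<delta>" "trace (F u) \<noteq> trace (F 0)"
    by blast
  define a b where ab: "a = min (trace (F u)) (trace (F 0))" "b = max (trace (F u)) (trace (F 0))"
  have "a < b" "- 2 \<le> a" "b \<le> 2"
    using u(2) bound1[OF u(1)] bound1[of 0] \<delta> by (auto simp: ab)
  then obtain \<theta> where \<theta>: "a < 2 * cos \<theta>" "2 * cos \<theta> < b" "\<theta> / (2 * pi) \<notin> \<rat>"
    by (rule exists_irrational_angle)
  \<comment> \<open>The intermediate value theorem realises the irrational angle at a small
    parameter \<open>t0\<close>.\<close>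
  have "connected ((\<lambda>t. trace (F t)) ` ball 0 \<delta>)"
    using complexifiable_isCont[OF tr]
    by (intro connected_continuous_image continuous_at_imp_continuous_on) auto
  moreover have "a \<in> (\<lambda>t. trace (F t)) ` ball 0 \<delta>" "b \<in> (\<lambda>t. trace (F t)) ` ball 0 \<delta>"
    using u(1) \<delta> by (auto simp: ab min_def max_def dist_real_def)
  ultimately have "2 * cos \<theta> \<in> (\<lambda>t. trace (F t)) ` ball 0 \<delta>"
    by (rule connectedD_interval) (use \<theta> in auto)
  then obtain t0 where t0: "trace (F t0) = 2 * cos \<theta>" "\<bar>t0\<bar> < \<delta>"
    by (auto simp: dist_real_def)
  have ell: "\<bar>trace (F t0)\<bar> < 2"
    using \<theta> t0 \<open>- 2 \<le> a\<close> \<open>b \<le> 2\<close> by linarith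
  have "fricke (F t0) (F t) = 0" if "\<bar>t\<bar> < \<delta>" for t
    using fricke_nonneg[OF det det ell] fricke_nonpos_if_bounded_orbit[OF det t0(1) \<theta>(3)]
      bound[OF t0(2) that] by (intro antisym) blast+
  then have "fricke (F t0) (F t1) = 0"
    by (rule complexifiable_identity[OF fricke_complexifiable[OF F] \<delta>])
  then have "\<bar>trace (F t1)\<bar> \<le> 2"
    using ell by (intro abs_trace_le_2_if_fricke_nonpos[of "F t0"]) auto
  then show False
    using hyp by simp
qed

lemma word_product_line_complexifiable:
  fixes A :: "'a::banach \<times> real \<Rightarrow> real^2^2"
  assumes "real_analytic A"
  shows "complexifiable (\<lambda>t. word_product A (map (\<lambda>x. x + t *\<^sub>R (y - x)) xs) E $ i $ j)"
proof (induction xs arbitrary: i j)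
  case Nil
  show ?case
    by (simp add: complexifiable_const)
next
  case (Cons x xs)
  have "bounded_linear (\<lambda>M::real^2^2. M $ k $ j)" for k
    by (intro bounded_linear_compose[OF bounded_linear_vec_nth bounded_linear_vec_nth])
  \<comment> \<open>The zero in the direction keeps \<open>E\<close> fixed along the line.\<close>
  from real_analytic_line_complexifiable[OF assms this, of "(x, E)" "(y - x, 0)"]
  have "complexifiable (\<lambda>t. A (x + t *\<^sub>R (y - x), E) $ k $ j)" for k
    by simp
  then show ?case
    by (simp add: matrix_matrix_mult_def)
      (intro complexifiable_sum complexifiable_mult Cons.IH)
qed

text \<open>The curve runs from \<open>x\<close> at parameter 0 to the constant word at parameter 1;
  concatenation of nearby words on it realises the hyperbolic product found near 0.\<close>

lemma hyperbolic_word_near: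
  fixes A :: "'a::banach \<times> real \<Rightarrow> real^2^2"
  assumes SL2: "\<forall>p. A p \<in> SL2" and A: "real_analytic A"
    and y: "hyperbolic (word_product A (replicate (length x) y) E)"
    and "x \<noteq> []" "\<epsilon> > 0"
  shows "\<exists>w\<in>words. word_dist x w < \<epsilon> \<and> hyperbolic (word_product A w E)"
proof -
  define \<omega> where "\<omega> t = map (\<lambda>z. z + t *\<^sub>R (y - z)) x" for t
  define F where "F t = word_product A (\<omega> t) E" for t
  \<comment> \<open>\<open>C\<close> bounds the speed of every letter; the \<open>+ 1\<close> keeps
    it positive when all letters equal \<open>y\<close>.\<close>
  define C where "C = (\<Sum>z\<leftarrow>x. norm (y - z)) + 1"
  have "(\<Sum>z\<leftarrow>x. norm (y - z)) \<ge> 0"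
    by (rule sum_list_nonneg) auto
  then have C: "C > 0"
    unfolding C_def by simp
  define \<delta> where "\<delta> = \<epsilon> / 2 / C"
  have "\<delta> > 0"
    using C \<open>\<epsilon> > 0\<close> by (simp add: \<delta>_def)
  have dist_le: "dist (x ! i) (\<omega> t ! i) \<le> \<epsilon> / 2" if "\<bar>t\<bar> < \<delta>" "i < length x" for t i
  proof -
    have "norm (y - x ! i) \<le> (\<Sum>z\<leftarrow>x. norm (y - z))"
      by (rule member_le_sum_list) (use that(2) in auto)
    then have "norm (y - x ! i) \<le> C"
      by (simp add: C_def)
    then have "\<bar>t\<bar> * norm (y - x ! i) \<le> \<delta> * C"
      using that(1) by (intro mult_mono) auto
    then show ?thesis
      using that(2) C by (simp add: \<omega>_def dist_norm \<delta>_def)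
  qed
  have "complexifiable (\<lambda>t. F t $ i $ j)" for i j
    unfolding F_def \<omega>_def by (rule word_product_line_complexifiable[OF A])
  moreover have "det (F t) = 1" for t
    using word_product_in_SL2[OF SL2] unfolding F_def SL2_def by blast
  moreover have "\<omega> 1 = replicate (length x) y"
    unfolding \<omega>_def by (simp add: map_replicate_const)
  then have "\<bar>trace (F 1)\<bar> > 2"
    using y unfolding F_def hyperbolic_def by simp
  ultimately obtain t0 t n where t: "\<bar>t0\<bar> < \<delta>" "\<bar>t\<bar> < \<delta>"
    and tr: "\<bar>trace (((**) (F t0) ^^ n) (F t))\<bar> > 2"
    using curve_hyperbolic_semigroup \<open>\<delta> > 0\<close> by metis
  \<comment> \<open>The block of \<open>t\<close> comes first since the first letters form the
    rightmost factor.\<close>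
  define w where "w = concat (\<omega> t # replicate n (\<omega> t0))"
  have "w \<noteq> []"
    using \<open>x \<noteq> []\<close> by (simp add: w_def \<omega>_def)
  moreover have "word_dist x w \<le> \<epsilon> / 2"
    unfolding w_def
  proof (rule word_dist_concat_le)
    fix v assume "v \<in> set (\<omega> t # replicate n (\<omega> t0))"
    then have v: "v \<in> {\<omega> t, \<omega> t0}"
      by (auto split: if_splits)
    then show "length v = length x"
      by (auto simp: \<omega>_def)
    show "dist (x ! i) (v ! i) \<le> \<epsilon> / 2" if "i < length x" for i
      using v t dist_le that by blast
  qed (use \<open>x \<noteq> []\<close> in auto)
  moreover have "hyperbolic (word_product A w E)"
    unfolding hyperbolic_def
    using tr word_product_in_SL2[OF SL2, of w E]
    by (simp add: w_def word_product_append_replicate F_def)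
  ultimately show ?thesis
    using \<open>\<epsilon> > 0\<close> by (auto simp: words_def)
qed

text \<open>Supplies the hyperbolic endpoint of the curve: a constant word gives a power of one
  hyperbolic matrix.\<close>

lemma hyperbolic_word_product_replicate:
  assumes SL2: "\<forall>p. A p \<in> SL2" and hyp: "hyperbolic (A (y, E))" and "n > 0"
  shows "hyperbolic (word_product A (replicate n y) E)"
proof -
  have "word_product A (replicate n y) E = ((**) (A (y, E)) ^^ n) (mat 1)"
    using word_product_append_replicate[of A "[]" n "[y]" E] by simp
  moreover obtain k where "n = Suc k"
    using \<open>n > 0\<close> gr0_implies_Suc by blast
  moreover have "det (A (y, E)) = 1"
    using SL2 by (simp add: SL2_def)
  ultimately have "\<bar>trace (word_product A (replicate n y) E)\<bar> > 2"
    using trace_funpow_hyperbolic[of "A (y, E)" k] hyp unfolding hyperbolic_def by metis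
  then show ?thesis
    using word_product_in_SL2[OF SL2] unfolding hyperbolic_def by blast
qed

theorem theorem2p3:
  fixes A :: "'a::banach \<times> real \<Rightarrow> real^2^2"
  assumes "\<forall>p. A p \<in> SL2"
    and "real_analytic A"
    and "non_ahyperbolic A"
  shows "gap_rich A"
proof -
  obtain S where S: "discrete S" "\<And>E. E \<notin> S \<Longrightarrow> \<exists>y. hyperbolic (A (y, E))"
    using assms(3) unfolding non_ahyperbolic_def non_ahyperbolic_with_def by blast
  have "\<exists>w\<in>words. word_dist x w < \<epsilon> \<and> hyperbolic (word_product A w E)"
    if E: "E \<notin> S" and x: "x \<in> words" and \<epsilon>: "\<epsilon> > 0" for E x \<epsilon>
  proof -
    obtain y where "hyperbolic (A (y, E))"
      using S(2)[OF E] by blast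
    moreover have "x \<noteq> []"
      using x by (simp add: words_def)
    ultimately show ?thesis
      using hyperbolic_word_near[OF assms(1,2)] hyperbolic_word_product_replicate[OF assms(1)] \<epsilon>
      by (metis length_greater_0_conv)
  qed
  then have "gap_rich_with A S"
    using S(1) unfolding gap_rich_with_def by blast
  then show ?thesis
    unfolding gap_rich_def by blast
qed

end
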